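(* Let $\mathsf{H}_0\in\mathbb{R}$. The optimal privacy-aware estimator design problem with discretized measurements, over $P=(P_{il})_{1\le i\le m,\,1\le l\le N}\in\mathbb{R}^{m\times N}$, $$\text{minimize } \mathsf{E}\big[L(Y,\hat Y_P(Z))\big]\quad\text{subject to}\quad P_{il}\ge 0\ \ \forall i,l,\qquad \sum_{i=1}^m P_{il}=1\ \ \forall l,\qquad \mathsf{H}[X\mid\hat Y_P(Z)]\ge\mathsf{H}_0,$$ is a (finite-dimensional) convex optimization problem.
   Context: $X$ (private) and $Y$ (public) are possibly correlated discrete random variables with finite support sets $\mathcal{X}=\{x_1,\dots,x_n\}$ and $\mathcal{Y}=\{y_1,\dots,y_m\}$. The measurement $Z$ is a real random variable, jointly distributed with $(X,Y)$, absolutely continuous with respect to Lebesgue measure. $\{B_l\}_{l=1}^N$ is a partition of $\mathbb{R}$ into intervals (up to endpoints, which have probability zero), with $B_1,B_N$ semi-infinite and $B_2,\dots,B_{N-1}$ bounded. Randomized estimator from discretized measurements: for $P_{il}\ge0$ with $\sum_iP_{il}=1$ for all $l$, $\hat Y_P(Z)$ is the $\mathcal{Y}$-valued random variable that equals $y_i$ with probability $P_{il}$ when $Z\in B_l$, the randomization being conditionally independent of $(X,Y)$ given $Z$. Loss: $L(Y,\hat Y)=1$ if $Y\neq\hat Y$, and $0$ otherwise. $\mathsf{H}[X\mid\hat Y_P(Z)]=-\sum_{y}\Pr(\hat Y_P(Z)=y)\sum_{x}\Pr(X=x\mid\hat Y_P(Z)=y)\log\Pr(X=x\mid\hat Y_P(Z)=y)$,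 with $0\log0=0$ and terms with $\Pr(\hat Y_P(Z)=y)=0$ omitted. "Convex optimization problem" means that the objective is a convex function of $P$ and the feasible set is convex (with $P\mapsto \mathsf{H}_0-\mathsf{H}[X\mid\hat Y_P(Z)]$ convex on the set of $P$ satisfying the other constraints). *)

theory Defs
  imports "HOL-Probability.Probability"
begin

definition has_finite_support :: "'a measure \<Rightarrow> ('a \<Rightarrow> 'v) \<Rightarrow> 'v set \<Rightarrow> bool" where
  "has_finite_support M V S \<longleftrightarrow>
     finite S \<and> V \<in> measurable M (count_space S) \<and>
     (\<forall>v\<in>S. \<P>(\<omega> in M. V \<omega> = v) > 0)"

text \<open>A partition of the line into intervals up to endpoints: the blocks are nondegenerate
  intervals that overlap at most in endpoints and miss at most endpoints.  The index type plays
  the role of \<open>{1..N}\<close>, so \<open>Min UNIV\<close> and \<open>Max UNIV\<close> are the indices \<open>1\<close> and \<open>N\<close>.  For \<open>N \<ge> 2\<close>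
  the unbounded blocks are automatically semi-infinite, since no block can be the whole line.\<close>

definition interval_partition :: "('l::{finite,linorder} \<Rightarrow> real set) \<Rightarrow> bool" where
  "interval_partition B \<longleftrightarrow>
     (\<forall>l. is_interval (B l) \<and> interior (B l) \<noteq> {}) \<and>
     (\<forall>k l. k \<noteq> l \<longrightarrow> interior (B k) \<inter> interior (B l) = {}) \<and>
     (\<Union>l. closure (B l)) = UNIV \<and>
     (\<forall>l. bounded (B l) \<longleftrightarrow> l \<noteq> Min UNIV \<and> l \<noteq> Max UNIV)"

definition sigma_gen :: "'a measure \<Rightarrow> 'c measure \<Rightarrow> ('a \<Rightarrow> 'c) \<Rightarrow> 'a measure" where
  "sigma_gen M R W = vimage_algebra (space M) W R"

definition prob_given ::
    "'a measure \<Rightarrow> 'c measure \<Rightarrow> ('a \<Rightarrow> 'c) \<Rightarrow> ('a \<Rightarrow> bool) \<Rightarrow> 'a \<Rightarrow> real" where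
  "prob_given M R W Q = real_cond_exp M (sigma_gen M R W) (\<lambda>\<omega>. if Q \<omega> then 1 else 0)"

definition cond_indep_given ::
    "'a measure \<Rightarrow> 'u measure \<Rightarrow> ('a \<Rightarrow> 'u) \<Rightarrow> 'v measure \<Rightarrow> ('a \<Rightarrow> 'v) \<Rightarrow>
     'c measure \<Rightarrow> ('a \<Rightarrow> 'c) \<Rightarrow> bool" where
  "cond_indep_given M S U T V R W \<longleftrightarrow>
     (\<forall>A\<in>sets S. \<forall>C\<in>sets T. AE \<omega> in M.
        prob_given M R W (\<lambda>\<omega>. U \<omega> \<in> A \<and> V \<omega> \<in> C) \<omega> =
        prob_given M R W (\<lambda>\<omega>. U \<omega> \<in> A) \<omega> * prob_given M R W (\<lambda>\<omega>. V \<omega> \<in> C) \<omega>)"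

definition randomization_rules :: "(real ^ 'l ^ 'm) set" where
  "randomization_rules = {P. (\<forall>i l. P $ i $ l \<ge> 0) \<and> (\<forall>l. (\<Sum>i\<in>UNIV. P $ i $ l) = 1)}"

text \<open>\<open>V\<close> is a randomized estimator of \<open>Y\<close> based on the discretized measurement: given \<open>Z\<close> in
  block \<open>l\<close> it equals \<open>y i\<close> with probability \<open>P $ i $ l\<close>, and the randomization is conditionally
  independent of \<open>(X, Y)\<close> given \<open>Z\<close>.  These conditions determine the joint law of \<open>(X, Y, Z, V)\<close>.\<close>

definition randomized_estimator ::
    "'a measure \<Rightarrow> ('a \<Rightarrow> 'x) \<Rightarrow> ('a \<Rightarrow> 'y) \<Rightarrow> ('a \<Rightarrow> real) \<Rightarrow>
     ('n \<Rightarrow> 'x) \<Rightarrow> ('m \<Rightarrow> 'y) \<Rightarrow> ('l \<Rightarrow> real set) \<Rightarrow> real ^ 'l ^ 'm \<Rightarrow> ('a \<Rightarrow> 'y) \<Rightarrow> bool" where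
  "randomized_estimator M X Y Z x y B P V \<longleftrightarrow>
     V \<in> measurable M (count_space (range y)) \<and>
     (\<forall>i. AE \<omega> in M. \<forall>l. Z \<omega> \<in> B l \<longrightarrow> prob_given M borel Z (\<lambda>\<omega>. V \<omega> = y i) \<omega> = P $ i $ l) \<and>
     cond_indep_given M (count_space (range x \<times> range y)) (\<lambda>\<omega>. (X \<omega>, Y \<omega>))
       (count_space (range y)) V borel Z"

definition loss :: "'y \<Rightarrow> 'y \<Rightarrow> real" where
  "loss u v = (if u \<noteq> v then 1 else 0)"

text \<open>The convention \<open>0 log 0 = 0\<close> needs no case distinction: \<open>log b 0\<close> is a real number and is
  multiplied by \<open>0\<close>.\<close>

definition cond_entropy ::
    "real \<Rightarrow> 'a measure \<Rightarrow> 'x set \<Rightarrow> ('a \<Rightarrow> 'x) \<Rightarrow> 'v set \<Rightarrow> ('a \<Rightarrow> 'v) \<Rightarrow> real" where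
  "cond_entropy b M S X T V =
     - (\<Sum>v | v \<in> T \<and> \<P>(\<omega> in M. V \<omega> = v) \<noteq> 0. \<P>(\<omega> in M. V \<omega> = v) *
         (\<Sum>u\<in>S. \<P>(\<omega> in M. X \<omega> = u \<bar> V \<omega> = v) *
                   log b (\<P>(\<omega> in M. X \<omega> = u \<bar> V \<omega> = v))))"

end

theory Submission
  imports Defs
begin

text \<open>On the event that \<open>Z\<close> lies in block \<open>l\<close>, the estimator is independent of \<open>(X, Y)\<close> with
  conditional law \<open>P $ _ $ l\<close>, so every joint probability of \<open>(X, Y)\<close> and the estimator is a
  linear function of \<open>P\<close>.  Hence the expected loss is affine in \<open>P\<close>.  The negative conditional
  entropy is a sum of terms \<open>q log (q / p)\<close> with \<open>q = \<P>(X = x j, V = y i)\<close> and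
  \<open>p = \<P>(V = y i)\<close>, and the perspective function \<open>(q, p) \<mapsto> q log (q / p)\<close> is convex.\<close>

section \<open>Convexity of the perspective function of the logarithm\<close>

text \<open>The perspective function lies above its tangent plane at \<open>(Q, P)\<close>. Its
  partial derivatives there are \<open>ln (Q / P) + 1\<close> and \<open>- Q / P\<close>, and
  homogeneity of degree one leaves no constant term. For \<open>q > 0\<close> this is
  \<open>ln t \<le> t - 1\<close> at \<open>t = Q * p / (P * q)\<close>.\<close>

lemma mult_ln_divide_ge_tangent:
  fixes q p Q P :: real
  assumes "q \<ge> 0" "p \<ge> 0" "p = 0 \<Longrightarrow> q = 0" "Q > 0" "P > 0"
  shows "q * ln (Q / P) + q - Q * p / P \<le> q * ln (q / p)"
proof (cases "q = 0")
  case True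
  then show ?thesis using assms by simp
next
  case False
  with assms have "q > 0" "p > 0" by (auto simp: less_le)
  have "ln (Q / P) - ln (q / p) = ln (Q * p / (P * q))"
    using \<open>q > 0\<close> \<open>p > 0\<close> assms by (simp add: ln_div ln_mult)
  also have "\<dots> \<le> Q * p / (P * q) - 1"
    using \<open>q > 0\<close> \<open>p > 0\<close> assms by (intro ln_le_minus_one) simp
  finally have "q * (ln (Q / P) - ln (q / p)) \<le> q * (Q * p / (P * q) - 1)"
    using \<open>q > 0\<close> by (intro mult_left_mono) auto
  also have "\<dots> = Q * p / P - q"
    using \<open>q > 0\<close> \<open>P > 0\<close> by (simp add: field_simps)
  finally show ?thesis by (simp add: algebra_simps)
qed

text \<open>Two tangent inequalities, both at the point \<open>(q1 + q2, p1 + p2)\<close>, are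
  added; their correction terms cancel.\<close>

lemma log_sum_inequality_two:
  fixes q1 q2 p1 p2 :: real
  assumes "0 \<le> q1" "q1 \<le> p1" "0 \<le> q2" "q2 \<le> p2" "b > 1"
  shows "(q1 + q2) * log b ((q1 + q2) / (p1 + p2)) \<le> q1 * log b (q1 / p1) + q2 * log b (q2 / p2)"
proof (cases "q1 + q2 = 0")
  case True
  with assms have "q1 = 0" "q2 = 0" by auto
  then show ?thesis by simp
next
  case False
  define Q P where "Q = q1 + q2" and "P = p1 + p2"
  \<comment> \<open>Positivity of \<open>P\<close> comes from \<open>Q \<le> P\<close>.\<close>
  have "Q > 0" "P > 0" using False assms by (auto simp: Q_def P_def)
  \<comment> \<open>This is the cancellation: the terms subtracted in the two tangent planes add up
    to \<open>q1 + q2\<close>.\<close>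
  have "Q * p1 / P + Q * p2 / P = Q"
    using \<open>P > 0\<close> by (simp add: P_def flip: add_divide_distrib distrib_left)
  then have "Q * ln (Q / P) =
      (q1 * ln (Q / P) + q1 - Q * p1 / P) + (q2 * ln (Q / P) + q2 - Q * p2 / P)"
    by (simp add: Q_def distrib_right)
  also have "\<dots> \<le> q1 * ln (q1 / p1) + q2 * ln (q2 / p2)"
    using assms \<open>Q > 0\<close> \<open>P > 0\<close> by (intro add_mono mult_ln_divide_ge_tangent) auto
  finally have "Q * ln (Q / P) / ln b \<le> (q1 * ln (q1 / p1) + q2 * ln (q2 / p2)) / ln b"
    using \<open>b > 1\<close> by (intro divide_right_mono) auto
  then show ?thesis by (simp add: log_def Q_def P_def add_divide_distrib)
qed

text \<open>The log sum inequality is subadditivity of the perspective function; together with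
  positive homogeneity it gives convexity, which composition with a linear map preserves.\<close>

lemma convex_on_mult_log_divide:
  fixes f g :: "'v::real_vector \<Rightarrow> real"
  assumes "linear f" "linear g" "convex S" "b > 1"
    and bounds: "\<And>v. v \<in> S \<Longrightarrow> 0 \<le> f v \<and> f v \<le> g v"
  shows "convex_on S (\<lambda>v. f v * log b (f v / g v))"
proof (rule convex_onI)
  fix t :: real and u v assume t: "t > 0" "t < 1" and uv: "u \<in> S" "v \<in> S"
  \<comment> \<open>The weights are absorbed into numerators and denominators alike, so they cancel
    in the quotients \<open>q1 / p1\<close> and \<open>q2 / p2\<close>.\<close>
  define q1 q2 p1 p2 where "q1 = (1 - t) * f u" and "q2 = t * f v"
    and "p1 = (1 - t) * g u" and "p2 = t * g v"
  have "(q1 + q2) * log b ((q1 + q2) / (p1 + p2)) \<le> q1 * log b (q1 / p1) + q2 * log b (q2 / p2)"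
    using t bounds[OF uv(1)] bounds[OF uv(2)] \<open>b > 1\<close>
    by (intro log_sum_inequality_two) (auto simp: q1_def q2_def p1_def p2_def mult_left_mono)
  moreover have "f ((1 - t) *\<^sub>R u + t *\<^sub>R v) = q1 + q2" "g ((1 - t) *\<^sub>R u + t *\<^sub>R v) = p1 + p2"
    using assms(1,2) by (simp_all add: q1_def q2_def p1_def p2_def linear_add linear_scale)
  ultimately show "f ((1 - t) *\<^sub>R u + t *\<^sub>R v) *
        log b (f ((1 - t) *\<^sub>R u + t *\<^sub>R v) / g ((1 - t) *\<^sub>R u + t *\<^sub>R v))
      \<le> (1 - t) * (f u * log b (f u / g u)) + t * (f v * log b (f v / g v))"
    using t by (simp add: q1_def q2_def p1_def p2_def mult.assoc)
qed fact

section \<open>Closure properties of convexity, and the set of randomization rules\<close>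

lemma convex_on_sum_functions:
  fixes f :: "'i \<Rightarrow> 'v::real_vector \<Rightarrow> real"
  assumes "convex S" "\<And>i. i \<in> I \<Longrightarrow> convex_on S (f i)"
  shows "convex_on S (\<lambda>v. \<Sum>i\<in>I. f i v)"
  using assms(2)
  by (induction I rule: infinite_finite_induct) (auto simp: convex_on_const assms(1) intro: convex_on_add)

text \<open>Lets explicit formulas in the entries of \<open>P\<close> replace the loss and the
  entropy, since the two are known to agree only on \<open>randomization_rules\<close>.\<close>

lemma convex_on_cong_values:
  assumes "convex_on S g" "\<And>v. v \<in> S \<Longrightarrow> f v = g v"
  shows "convex_on S f"
proof -
  have "convex S" using assms(1) by (rule convex_on_imp_convex)
  then show ?thesis
    using assms by (intro convex_onI) (auto simp: convex_onD convexD)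
qed

lemma convex_on_imp_convex_sublevel:
  assumes "convex_on S f"
  shows "convex {v \<in> S. f v \<le> c}"
proof (rule convexI)
  fix u v and s t :: real
  assume *: "u \<in> {v \<in> S. f v \<le> c}" "v \<in> {v \<in> S. f v \<le> c}" "0 \<le> s" "0 \<le> t" "s + t = 1"
  then have "f (s *\<^sub>R u + t *\<^sub>R v) \<le> s * f u + t * f v"
    using assms by (auto simp: convex_on_def)
  also have "\<dots> \<le> c"
    using * by (intro convex_bound_le) auto
  finally show "s *\<^sub>R u + t *\<^sub>R v \<in> {v \<in> S. f v \<le> c}"
    using * convex_on_imp_convex[OF assms] by (auto simp: convexD)
qed

lemma convex_randomization_rules: "convex (randomization_rules :: (real ^ 'l ^ 'm) set)"
proof (rule convexI)
  fix P Q :: "real ^ 'l ^ 'm" and u v :: real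
  assume *: "P \<in> randomization_rules" "Q \<in> randomization_rules" "0 \<le> u" "0 \<le> v" "u + v = 1"
  have "(\<Sum>i\<in>UNIV. u * P $ i $ l + v * Q $ i $ l) = 1" for l
    using * by (simp add: randomization_rules_def sum.distrib flip: sum_distrib_left)
  then show "u *\<^sub>R P + v *\<^sub>R Q \<in> randomization_rules"
    using * by (simp add: randomization_rules_def)
qed

section \<open>Almost every real number lies in exactly one block\<close>

lemma interval_partition_borel:
  assumes "interval_partition B"
  shows "B l \<in> sets borel"
  using assms by (auto simp: interval_partition_def intro: real_interval_borel_measurable)

text \<open>The exceptional points lie on the frontiers of the blocks, and frontiers of convex sets
  are null.\<close>

lemma interval_partition_AE:
  fixes B :: "'l::{finite,linorder} \<Rightarrow> real set"
  assumes "interval_partition B"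
  shows "AE z in lborel. \<exists>!l. z \<in> B l"
proof -
  have "frontier (B l) \<in> null_sets lborel" for l
  proof -
    have "convex (B l)"
      using assms by (simp add: interval_partition_def is_interval_convex)
    then have "frontier (B l) \<in> null_sets lebesgue"
      using negligible_convex_frontier negligible_iff_null_sets by blast
    \<comment> \<open>A frontier is closed, hence Borel, so nullity for the completed measure passes
      to \<open>lborel\<close>.\<close>
    then show ?thesis by (simp add: null_sets_completion_iff)
  qed
  then have "(\<Union>l. frontier (B l)) \<in> null_sets lborel"
    by (intro null_sets_UN') auto
  then show ?thesis
  proof (rule AE_I', intro subsetI)
    fix z assume z: "z \<in> {z \<in> space lborel. \<not> (\<exists>!l. z \<in> B l)}"
    show "z \<in> (\<Union>l. frontier (B l))"
    proof (rule ccontr)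
      assume "z \<notin> (\<Union>l. frontier (B l))"
      \<comment> \<open>Off the frontiers closure and interior agree: the closures cover the line,
        which gives existence, and the interiors are disjoint, which gives uniqueness.\<close>
      then have int: "z \<in> closure (B l) \<Longrightarrow> z \<in> interior (B l)" for l
        by (auto simp: frontier_def)
      have "z \<in> (\<Union>l. closure (B l))"
        using assms by (simp add: interval_partition_def)
      then obtain l where "z \<in> closure (B l)" by blast
      have "z \<in> B l" using int[OF \<open>z \<in> closure (B l)\<close>] interior_subset by blast
      moreover have "k = l" if "z \<in> B k" for k
      proof (rule ccontr)
        have "z \<in> interior (B k) \<inter> interior (B l)"
          using int that \<open>z \<in> closure (B l)\<close> closure_subset by blast
        moreover assume "k \<noteq> l"
        ultimately show False using assms by (auto simp: interval_partition_def)
      qed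
      ultimately have "\<exists>!l. z \<in> B l" by blast
      with z show False by simp
    qed
  qed
qed

section \<open>Joint law of the data and the randomized estimator\<close>

lemma sets_Collect_eq_count_space:
  assumes "V \<in> measurable M (count_space S)" "u \<in> S"
  shows "{\<omega> \<in> space M. V \<omega> = u} \<in> sets M"
proof -
  have "V -` {u} \<inter> space M \<in> sets M"
    using assms by (intro measurable_sets) auto
  also have "V -` {u} \<inter> space M = {\<omega> \<in> space M. V \<omega> = u}" by auto
  finally show ?thesis .
qed

context prob_space
begin

text \<open>The defining property of conditional expectation, applied to an indicator and to an
  event of the sigma-algebra generated by \<open>W\<close>.\<close>

lemma set_integral_prob_given:
  assumes W: "W \<in> measurable M R" and Q: "{\<omega> \<in> space M. Q \<omega>} \<in> events" and D: "D \<in> sets R"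
  shows "(\<integral>\<omega>\<in>W -` D \<inter> space M. prob_given M R W Q \<omega> \<partial>M) = \<P>(\<omega> in M. Q \<omega> \<and> W \<omega> \<in> D)"
proof -
  have sub: "subalgebra M (sigma_gen M R W)"
    using W by (auto simp: subalgebra_def sigma_gen_def intro!: sets_vimage_algebra_space
        dest: measurable_iff_sets[THEN iffD1])
  interpret finite_measure_subalgebra M "sigma_gen M R W"
    by unfold_locales (fact sub)
  note [measurable] = W Q D
  have int: "integrable M (\<lambda>\<omega>. if Q \<omega> then 1 else 0 :: real)"
    by (rule integrable_const_bound[where B = 1]) auto
  have "W -` D \<inter> space M \<in> sets (sigma_gen M R W)"
    using D by (simp add: sigma_gen_def in_vimage_algebra)
  from real_cond_exp_intA[OF int this]
  have "(\<integral>\<omega>\<in>W -` D \<inter> space M. prob_given M R W Q \<omega> \<partial>M)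
      = (\<integral>\<omega>\<in>W -` D \<inter> space M. (if Q \<omega> then 1 else 0) \<partial>M)"
    by (simp add: prob_given_def)
  also have "\<dots> = (\<integral>\<omega>. indicator {\<omega> \<in> space M. Q \<omega> \<and> W \<omega> \<in> D} \<omega> \<partial>M)"
    unfolding set_lebesgue_integral_def
    by (intro Bochner_Integration.integral_cong) (auto simp: indicator_def)
  finally show ?thesis by simp
qed

text \<open>Given \<open>Z\<close>, the conditional probability factors by conditional independence.
  On block \<open>l\<close> the factor of the estimator is the constant \<open>P $ i $ l\<close>,
  which leaves the integral over that block.\<close>

lemma prob_randomized_estimator_block:
  fixes P :: "real ^ 'l ^ 'm::finite"
  assumes Z: "Z \<in> borel_measurable M" and B: "B l \<in> sets borel"
    and est: "randomized_estimator M X Y Z x y B P V"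
    and A: "A \<subseteq> range x \<times> range y" "{\<omega> \<in> space M. (X \<omega>, Y \<omega>) \<in> A} \<in> events"
  shows "\<P>(\<omega> in M. ((X \<omega>, Y \<omega>) \<in> A \<and> V \<omega> = y i) \<and> Z \<omega> \<in> B l)
    = P $ i $ l * \<P>(\<omega> in M. (X \<omega>, Y \<omega>) \<in> A \<and> Z \<omega> \<in> B l)"
proof -
  have V: "{\<omega> \<in> space M. V \<omega> = y i} \<in> events"
    using est by (auto simp: randomized_estimator_def intro: sets_Collect_eq_count_space)
  let ?E = "Z -` B l \<inter> space M"
  have "AE \<omega> in M. \<forall>l. Z \<omega> \<in> B l \<longrightarrow> prob_given M borel Z (\<lambda>\<omega>. V \<omega> = y i) \<omega> = P $ i $ l"
    using est by (simp add: randomized_estimator_def)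
  moreover have "AE \<omega> in M. prob_given M borel Z (\<lambda>\<omega>. (X \<omega>, Y \<omega>) \<in> A \<and> V \<omega> \<in> {y i}) \<omega> =
      prob_given M borel Z (\<lambda>\<omega>. (X \<omega>, Y \<omega>) \<in> A) \<omega> * prob_given M borel Z (\<lambda>\<omega>. V \<omega> \<in> {y i}) \<omega>"
    using est A(1) unfolding randomized_estimator_def cond_indep_given_def
    by (auto dest!: bspec[of _ _ A] bspec[of _ _ "{y i}"])
  \<comment> \<open>The indicator annihilates both sides off the block, so the identity holds almost
    everywhere and the integrals can be compared.\<close>
  ultimately have AE: "AE \<omega> in M. indicator ?E \<omega> *\<^sub>R
      prob_given M borel Z (\<lambda>\<omega>. (X \<omega>, Y \<omega>) \<in> A \<and> V \<omega> = y i) \<omega> =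
      P $ i $ l * (indicator ?E \<omega> *\<^sub>R prob_given M borel Z (\<lambda>\<omega>. (X \<omega>, Y \<omega>) \<in> A) \<omega>)"
    by eventually_elim (auto simp: indicator_def)
  have meas: "prob_given M borel Z Q \<in> borel_measurable M" for Q
    by (simp add: prob_given_def)
  have "?E \<in> events" using Z B by (rule measurable_sets)
  have "{\<omega> \<in> space M. (X \<omega>, Y \<omega>) \<in> A \<and> V \<omega> = y i} \<in> events"
    using V A(2) by (rule sets.sets_Collect_conj)
  from set_integral_prob_given[OF Z this B]
  have "\<P>(\<omega> in M. ((X \<omega>, Y \<omega>) \<in> A \<and> V \<omega> = y i) \<and> Z \<omega> \<in> B l) =
      (\<integral>\<omega>\<in>?E. prob_given M borel Z (\<lambda>\<omega>. (X \<omega>, Y \<omega>) \<in> A \<and> V \<omega> = y i) \<omega> \<partial>M)" by simp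
  also have "\<dots> = (\<integral>\<omega>. P $ i $ l *
      (indicator ?E \<omega> *\<^sub>R prob_given M borel Z (\<lambda>\<omega>. (X \<omega>, Y \<omega>) \<in> A) \<omega>) \<partial>M)"
    unfolding set_lebesgue_integral_def
    using AE \<open>?E \<in> events\<close> meas
    by (intro integral_cong_AE borel_measurable_times borel_measurable_scaleR borel_measurable_indicator) auto
  also have "\<dots> = P $ i $ l * (\<integral>\<omega>\<in>?E. prob_given M borel Z (\<lambda>\<omega>. (X \<omega>, Y \<omega>) \<in> A) \<omega> \<partial>M)"
    by (simp add: set_lebesgue_integral_def)
  finally show ?thesis
    by (simp add: set_integral_prob_given[OF Z A(2) B])
qed

text \<open>Law of total probability over the blocks. The coefficients on the right do not involve
  the estimator, so the dependence on \<open>P\<close> is linear.\<close>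

lemma prob_randomized_estimator:
  fixes P :: "real ^ 'l ^ 'm::finite"
  assumes Z: "Z \<in> borel_measurable M" and B: "\<And>l. B l \<in> sets borel"
    and part: "AE \<omega> in M. \<exists>!l. Z \<omega> \<in> B l"
    and est: "randomized_estimator M X Y Z x y B P V"
    and A: "A \<subseteq> range x \<times> range y" "{\<omega> \<in> space M. (X \<omega>, Y \<omega>) \<in> A} \<in> events"
  shows "\<P>(\<omega> in M. (X \<omega>, Y \<omega>) \<in> A \<and> V \<omega> = y i)
    = (\<Sum>l\<in>UNIV. P $ i $ l * \<P>(\<omega> in M. (X \<omega>, Y \<omega>) \<in> A \<and> Z \<omega> \<in> B l))"
proof -
  have V: "{\<omega> \<in> space M. V \<omega> = y i} \<in> events"
    using est by (auto simp: randomized_estimator_def intro: sets_Collect_eq_count_space)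
  have "{\<omega> \<in> space M. Z \<omega> \<in> B l} \<in> events" for l
    using Z B by measurable
  then have E: "{\<omega> \<in> space M. ((X \<omega>, Y \<omega>) \<in> A \<and> V \<omega> = y i) \<and> Z \<omega> \<in> B l} \<in> events" for l
    using A(2) V by (intro sets.sets_Collect_conj) auto
  have "\<P>(\<omega> in M. (X \<omega>, Y \<omega>) \<in> A \<and> V \<omega> = y i)
    = (\<Sum>l\<in>UNIV. \<P>(\<omega> in M. ((X \<omega>, Y \<omega>) \<in> A \<and> V \<omega> = y i) \<and> Z \<omega> \<in> B l))"
  proof (rule prob_sum)
    show "{\<omega> \<in> space M. (X \<omega>, Y \<omega>) \<in> A \<and> V \<omega> = y i} \<in> events"
      using V A(2) by (rule sets.sets_Collect_conj)
    show "AE \<omega> in M. (\<forall>l\<in>UNIV. ((X \<omega>, Y \<omega>) \<in> A \<and> V \<omega> = y i) \<and> Z \<omega> \<in> B l \<longrightarrow>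
          (X \<omega>, Y \<omega>) \<in> A \<and> V \<omega> = y i) \<and>
        ((X \<omega>, Y \<omega>) \<in> A \<and> V \<omega> = y i \<longrightarrow>
          (\<exists>!l. l \<in> UNIV \<and> ((X \<omega>, Y \<omega>) \<in> A \<and> V \<omega> = y i) \<and> Z \<omega> \<in> B l))"
      using part by eventually_elim simp
  qed (use E in auto)
  then show ?thesis
    unfolding prob_randomized_estimator_block[OF Z B est A] .
qed

end

section \<open>Loss and entropy as functions of the matrix \<open>P\<close>\<close>

lemma linear_row_sum: "linear (\<lambda>P :: real ^ 'l ^ 'm. \<Sum>l\<in>UNIV. P $ i $ l * c l)"
  by (intro linearI) (simp_all add: distrib_right sum.distrib sum_distrib_left mult.assoc)

theorem mainTheorem10:
  fixes M :: "'a measure"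
    and X :: "'a \<Rightarrow> 'x" and Y :: "'a \<Rightarrow> 'y" and Z :: "'a \<Rightarrow> real"
    and x :: "'n::finite \<Rightarrow> 'x" and y :: "'m::finite \<Rightarrow> 'y"
    and B :: "'l::{finite,linorder} \<Rightarrow> real set"
    and Yhat :: "real ^ ('l::{finite,linorder}) ^ 'm \<Rightarrow> 'a \<Rightarrow> 'y"
    and b H\<^sub>0 :: real
  assumes "prob_space M"
    and "inj x" and "has_finite_support M X (range x)"
    and "inj y" and "has_finite_support M Y (range y)"
    and "Z \<in> borel_measurable M" and "absolutely_continuous lborel (distr M borel Z)"
    and "interval_partition B"
    and "\<And>P. P \<in> randomization_rules \<Longrightarrow> randomized_estimator M X Y Z x y B P (Yhat P)"
    and "b > 1"
  shows "convex_on randomization_rules (\<lambda>P. \<integral>\<omega>. loss (Y \<omega>) (Yhat P \<omega>) \<partial>M) \<and>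
    convex_on randomization_rules
      (\<lambda>P. H\<^sub>0 - cond_entropy b M (range x) X (range y) (Yhat P)) \<and>
    convex {P \<in> randomization_rules.
      cond_entropy b M (range x) X (range y) (Yhat P) \<ge> H\<^sub>0}"
proof -
  interpret prob_space M by fact
  \<comment> \<open>For rules \<open>P\<close>, these will be the probabilities of
    \<open>X = x j\<close> with estimate \<open>y i\<close>, of \<open>Y\<close> and the estimate
    both being \<open>y i\<close>, and of estimate \<open>y i\<close>. As formulas they make sense
    for every matrix, so linearity can be stated on the whole space.\<close>
  define J where "J j i P = (\<Sum>l\<in>UNIV. P $ i $ l * \<P>(\<omega> in M. X \<omega> = x j \<and> Z \<omega> \<in> B l))"
    for j i and P :: "real ^ ('l::{finite,linorder}) ^ 'm"
  define K where "K i P = (\<Sum>l\<in>UNIV. P $ i $ l * \<P>(\<omega> in M. Y \<omega> = y i \<and> Z \<omega> \<in> B l))"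
    for i and P :: "real ^ ('l::{finite,linorder}) ^ 'm"
  define W where "W i P = (\<Sum>l\<in>UNIV. P $ i $ l * \<P>(\<omega> in M. Z \<omega> \<in> B l))"
    for i and P :: "real ^ ('l::{finite,linorder}) ^ 'm"
  have lin: "linear (J j i)" "linear (K i)" "linear (W i)" for i j
    unfolding J_def K_def W_def by (rule linear_row_sum)+
  let ?R = "randomization_rules :: (real ^ ('l::{finite,linorder}) ^ 'm) set"

  have X: "X \<in> measurable M (count_space (range x))" and Y: "Y \<in> measurable M (count_space (range y))"
    using assms(3,5) by (simp_all add: has_finite_support_def)
  have Xmeas: "{\<omega> \<in> space M. X \<omega> = x j} \<in> events" for j
    using X by (rule sets_Collect_eq_count_space) simp
  have Ymeas: "{\<omega> \<in> space M. Y \<omega> = y i} \<in> events" for i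
    using Y by (rule sets_Collect_eq_count_space) simp
  have Xrange: "X \<omega> \<in> range x" and Yrange: "Y \<omega> \<in> range y" if "\<omega> \<in> space M" for \<omega>
    using measurable_space[OF X that] measurable_space[OF Y that] by simp_all
  \<comment> \<open>Absolute continuity makes the Lebesgue-null exceptional set null for the law of
    \<open>Z\<close>.\<close>
  have part: "AE \<omega> in M. \<exists>!l. Z \<omega> \<in> B l"
  proof (rule AE_distrD[OF assms(6)])
    show "AE z in distr M borel Z. \<exists>!l. z \<in> B l"
      by (rule absolutely_continuous_AE[OF _ assms(7) interval_partition_AE[OF assms(8)]]) simp
  qed

  have joint: "\<P>(\<omega> in M. (X \<omega>, Y \<omega>) \<in> A \<and> Yhat P \<omega> = y i)
    = (\<Sum>l\<in>UNIV. P $ i $ l * \<P>(\<omega> in M. (X \<omega>, Y \<omega>) \<in> A \<and> Z \<omega> \<in> B l))"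
    if "P \<in> ?R" "A \<subseteq> range x \<times> range y" "{\<omega> \<in> space M. (X \<omega>, Y \<omega>) \<in> A} \<in> events" for P A i
    by (rule prob_randomized_estimator[OF assms(6) interval_partition_borel[OF assms(8)] part
        assms(9)[OF that(1)] that(2,3)])
  have J: "\<P>(\<omega> in M. X \<omega> = x j \<and> Yhat P \<omega> = y i) = J j i P" if "P \<in> ?R" for P i j
  proof -
    have "{\<omega> \<in> space M. (X \<omega>, Y \<omega>) \<in> {x j} \<times> range y \<and> Q \<omega>} = {\<omega> \<in> space M. X \<omega> = x j \<and> Q \<omega>}" for Q
      by (simp add: Yrange cong: conj_cong)
    \<comment> \<open>The first copy rewrites the probabilities in \<open>joint\<close>; the
      instance at \<open>True\<close> rewrites its measurability premise.\<close>
    note eq = this this[of "\<lambda>_. True", unfolded simp_thms]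
    have "{x j} \<times> range y \<subseteq> range x \<times> range y" by auto
    from joint[OF that this, of i, unfolded eq] Xmeas[of j] show ?thesis by (simp add: J_def)
  qed
  have K: "\<P>(\<omega> in M. Y \<omega> = y i \<and> Yhat P \<omega> = y i) = K i P" if "P \<in> ?R" for P i
  proof -
    have "{\<omega> \<in> space M. (X \<omega>, Y \<omega>) \<in> range x \<times> {y i} \<and> Q \<omega>} = {\<omega> \<in> space M. Y \<omega> = y i \<and> Q \<omega>}" for Q
      by (simp add: Xrange cong: conj_cong)
    note eq = this this[of "\<lambda>_. True", unfolded simp_thms]
    have "range x \<times> {y i} \<subseteq> range x \<times> range y" by auto
    from joint[OF that this, of i, unfolded eq] Ymeas[of i] show ?thesis by (simp add: K_def)
  qed
  have W: "\<P>(\<omega> in M. Yhat P \<omega> = y i) = W i P" if "P \<in> ?R" for P i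
  proof -
    have "{\<omega> \<in> space M. (X \<omega>, Y \<omega>) \<in> range x \<times> range y \<and> Q \<omega>} = {\<omega> \<in> space M. Q \<omega>}" for Q
      by (simp add: Xrange Yrange cong: conj_cong)
    note eq = this this[of "\<lambda>_. True", unfolded simp_thms]
    have "range x \<times> range y \<subseteq> range x \<times> range y" by auto
    from joint[OF that this, of i, unfolded eq] show ?thesis by (simp add: W_def)
  qed
  have Vmeas: "{\<omega> \<in> space M. Yhat P \<omega> = y i} \<in> events" if "P \<in> ?R" for P i
    using assms(9)[OF that]
    by (auto simp: randomized_estimator_def intro: sets_Collect_eq_count_space)
  \<comment> \<open>The bounds follow from reading both formulas as probabilities of nested events;
    in particular \<open>J j i P\<close> vanishes wherever \<open>W i P\<close> does.\<close>
  have JW: "0 \<le> J j i P \<and> J j i P \<le> W i P" if "P \<in> ?R" for j i P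
    unfolding J[OF that, symmetric] W[OF that, symmetric]
    using Vmeas[OF that] by (auto intro!: finite_measure_mono)

  have loss: "(\<integral>\<omega>. loss (Y \<omega>) (Yhat P \<omega>) \<partial>M) = 1 + (\<Sum>i\<in>UNIV. - K i P)" if "P \<in> ?R" for P
  proof -
    let ?E = "\<lambda>i. {\<omega> \<in> space M. Y \<omega> = y i \<and> Yhat P \<omega> = y i}"
    have E: "?E i \<in> events" for i
      using Ymeas[of i] Vmeas[OF that, of i] by (auto intro: sets.sets_Collect_conj)
    \<comment> \<open>The events of a correct estimate with value \<open>y i\<close> are disjoint
      because \<open>y\<close> is injective, so the sum is the indicator of a correct
      estimate.\<close>
    have "loss (Y \<omega>) (Yhat P \<omega>) = 1 - (\<Sum>i\<in>UNIV. indicator (?E i) \<omega>)" if \<omega>: "\<omega> \<in> space M" for \<omega>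
    proof -
      obtain k where k: "Y \<omega> = y k" using Yrange[OF \<omega>] by auto
      have "(\<Sum>i\<in>UNIV. indicator (?E i) \<omega>) = (\<Sum>i\<in>UNIV. if i = k \<and> Yhat P \<omega> = y k then 1 else 0 :: real)"
        using \<omega> k \<open>inj y\<close> by (intro sum.cong) (auto simp: indicator_def inj_eq)
      then show ?thesis using k by (cases "Yhat P \<omega> = y k") (auto simp: loss_def)
    qed
    then have "(\<integral>\<omega>. loss (Y \<omega>) (Yhat P \<omega>) \<partial>M) = (\<integral>\<omega>. 1 - (\<Sum>i\<in>UNIV. indicator (?E i) \<omega>) \<partial>M)"
      by (intro Bochner_Integration.integral_cong) auto
    also have "\<dots> = 1 - (\<Sum>i\<in>UNIV. prob (?E i))"
      using E by (subst Bochner_Integration.integral_diff)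
        (auto simp: prob_space Bochner_Integration.integral_sum less_top[symmetric])
    finally show ?thesis by (simp add: K[OF that] sum_negf)
  qed

  have entropy: "H\<^sub>0 - cond_entropy b M (range x) X (range y) (Yhat P)
      = H\<^sub>0 + (\<Sum>i\<in>UNIV. \<Sum>j\<in>UNIV. J j i P * log b (J j i P / W i P))" if P: "P \<in> ?R" for P
  proof -
    let ?p = "\<lambda>v. \<P>(\<omega> in M. Yhat P \<omega> = v)"
    let ?c = "\<lambda>u v. \<P>(\<omega> in M. X \<omega> = u \<bar> Yhat P \<omega> = v)"
    have "- cond_entropy b M (range x) X (range y) (Yhat P)
        = (\<Sum>v\<in>range y. ?p v * (\<Sum>u\<in>range x. ?c u v * log b (?c u v)))"
      unfolding cond_entropy_def minus_minus by (rule sum.mono_neutral_left) auto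
    also have "\<dots> = (\<Sum>i\<in>UNIV. ?p (y i) * (\<Sum>j\<in>UNIV. ?c (x j) (y i) * log b (?c (x j) (y i))))"
      using \<open>inj x\<close> \<open>inj y\<close> by (simp add: sum.reindex)
    also have "\<dots> = (\<Sum>i\<in>UNIV. \<Sum>j\<in>UNIV. J j i P * log b (J j i P / W i P))"
    proof (intro sum.cong refl)
      fix i
      \<comment> \<open>If \<open>W i P = 0\<close>, then \<open>J j i P = 0\<close> by
        \<open>JW\<close> and both sides vanish; otherwise \<open>W i P\<close> cancels.\<close>
      have "W i P * (J j i P / W i P * log b (J j i P / W i P)) = J j i P * log b (J j i P / W i P)" for j
        using JW[OF P, of j i] by (cases "W i P = 0") auto
      then show "?p (y i) * (\<Sum>j\<in>UNIV. ?c (x j) (y i) * log b (?c (x j) (y i)))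
          = (\<Sum>j\<in>UNIV. J j i P * log b (J j i P / W i P))"
        by (simp add: cond_prob_def J[OF P] W[OF P] sum_distrib_left)
    qed
    finally show ?thesis by simp
  qed

  \<comment> \<open>The function is affine, so each summand satisfies the convexity inequality with
    equality.\<close>
  have "convex_on ?R (\<lambda>P. 1 + (\<Sum>i\<in>UNIV. - K i P))"
    using lin convex_randomization_rules
    by (intro convex_on_add convex_on_sum_functions convex_on_const[THEN iffD2] convex_onI)
       (auto simp: linear_add linear_scale)
  then have loss_convex: "convex_on ?R (\<lambda>P. \<integral>\<omega>. loss (Y \<omega>) (Yhat P \<omega>) \<partial>M)"
    using loss by (rule convex_on_cong_values)
  have "convex_on ?R (\<lambda>P. H\<^sub>0 + (\<Sum>i\<in>UNIV. \<Sum>j\<in>UNIV. J j i P * log b (J j i P / W i P)))"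
    using lin JW \<open>b > 1\<close> convex_randomization_rules
    by (intro convex_on_add convex_on_sum_functions convex_on_const[THEN iffD2]
        convex_on_mult_log_divide) auto
  then have entropy_convex:
    "convex_on ?R (\<lambda>P. H\<^sub>0 - cond_entropy b M (range x) X (range y) (Yhat P))"
    using entropy by (rule convex_on_cong_values)
  \<comment> \<open>The entropy constraint is a sublevel set, at level zero, of the convex
    constraint function.\<close>
  have "convex {P \<in> ?R. H\<^sub>0 - cond_entropy b M (range x) X (range y) (Yhat P) \<le> 0}"
    using entropy_convex by (rule convex_on_imp_convex_sublevel)
  with loss_convex entropy_convex show ?thesis by simp
qed

end
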